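(* Let $n$ be a positive integer and let $\mathcal{L} = \{\ell_{1}, \ldots, \ell_{3n}\} \subset \mathbb{P}^2$ be an arrangement of $3n$ lines in the complex projective plane satisfying Hirzebruch's property and such that all singular points of $\mathcal{L}$ have multiplicity greater than two. Then $$\varepsilon(\mathbb{P}^{2}, \mathcal{O}_{\mathbb{P}^{2}}(1); \, \mathrm{Sing}(\mathcal{L})) = \frac{1}{n+1}.$$
   Context: We work over the complex numbers. A line arrangement is a finite set of distinct lines in $\mathbb{P}^2$; its singular locus $\mathrm{Sing}(\mathcal{L})$ is the set of points lying on at least two lines of $\mathcal{L}$, and the multiplicity of a singular point is the number of lines of $\mathcal{L}$ passing through it. A line arrangement $\mathcal{L}$ satisfies Hirzebruch's property if the number of lines is equal to $3n$ for some positive integer $n$ and each line from $\mathcal{L}$ intersects the other lines at exactly $n+1$ points. For a finite set of points $\mathcal{P}=\{p_1,\dots,p_r\}\subset\mathbb{P}^2$, the multi-point Seshadri constant is $$\varepsilon(\mathbb{P}^{2}, \mathcal{O}_{\mathbb{P}^{2}}(1); \mathcal{P}) = \inf_{C \cap \mathcal{P} \neq \emptyset} \frac{\deg C}{\sum_{i=1}^{r} \mathrm{mult}_{p_{i}} C},$$ where the infimum is over all irreducible and reduced curves $C \subset \mathbb{P}^2$ passing through at least one point of $\mathcal{P}$. *)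

theory Defs
  imports
    "HOL-Analysis.Analysis"
    "HOL-Library.Poly_Mapping"
    "HOL-Computational_Algebra.Factorial_Ring"
begin

section \<open>The complex projective plane and its lines\<close>

text \<open>\<^verbatim>\<open>vec.span\<close> is the complex span, whereas plain \<^verbatim>\<open>span\<close> would be the real one.\<close>

typedef proj_plane = "{vec.span {v} | v :: complex ^ 3. v \<noteq> 0}"
  morphisms cone_of Proj_Point
proof
  show "vec.span {axis 1 1 :: complex ^ 3} \<in> {vec.span {v} | v :: complex ^ 3. v \<noteq> 0}"
    by (auto simp: axis_eq_0_iff)
qed

definition proj_line :: "proj_plane set \<Rightarrow> bool" where
  "proj_line l \<longleftrightarrow>
     (\<exists>a :: complex ^ 3. a \<noteq> 0 \<and> l = {p. \<forall>v \<in> cone_of p. (\<Sum>i\<in>UNIV. a $ i * v $ i) = 0})"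

section \<open>Line arrangements\<close>

definition line_arrangement :: "proj_plane set set \<Rightarrow> bool" where
  "line_arrangement L \<longleftrightarrow> finite L \<and> (\<forall>l \<in> L. proj_line l)"

definition Sing :: "proj_plane set set \<Rightarrow> proj_plane set" where
  "Sing L = {p. \<exists>l \<in> L. \<exists>l' \<in> L. l \<noteq> l' \<and> p \<in> l \<and> p \<in> l'}"

definition point_multiplicity :: "proj_plane set set \<Rightarrow> proj_plane \<Rightarrow> nat" where
  "point_multiplicity L p = card {l \<in> L. p \<in> l}"

definition hirzebruch_property :: "proj_plane set set \<Rightarrow> bool" where
  "hirzebruch_property L \<longleftrightarrow>
     (\<exists>n > 0. card L = 3 * n \<and>
        (\<forall>l \<in> L. card {p \<in> l. \<exists>l' \<in> L - {l}. p \<in> l'} = n + 1))"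

section \<open>Plane curves\<close>

text \<open>The polynomial ring in three variables over the complex numbers, as the monoid algebra
  of the monoid of exponent vectors.\<close>

type_synonym monomial3 = "3 \<Rightarrow>\<^sub>0 nat"
type_synonym poly3 = "monomial3 \<Rightarrow>\<^sub>0 complex"

definition Const :: "complex \<Rightarrow> poly3" where
  "Const c = Poly_Mapping.single 0 c"

definition Var :: "3 \<Rightarrow> poly3" where
  "Var i = Poly_Mapping.single (Poly_Mapping.single i 1) 1"

definition monom_degree :: "monomial3 \<Rightarrow> nat" where
  "monom_degree m = (\<Sum>i\<in>UNIV. Poly_Mapping.lookup m i)"

definition eval3 :: "poly3 \<Rightarrow> complex ^ 3 \<Rightarrow> complex" where
  "eval3 F v = (\<Sum>m\<in>Poly_Mapping.keys F.
     Poly_Mapping.lookup F m * (\<Prod>i\<in>UNIV. (v $ i) ^ Poly_Mapping.lookup m i))"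

definition homogeneous :: "poly3 \<Rightarrow> bool" where
  "homogeneous F \<longleftrightarrow> (\<exists>d. \<forall>m\<in>Poly_Mapping.keys F. monom_degree m = d)"

text \<open>An irreducible and reduced curve is given by its equation, an irreducible form, which
  the curve determines up to a nonzero constant factor. Irreducible elements of the polynomial
  ring are not units, so the degree is positive.\<close>

definition integral_curve :: "poly3 \<Rightarrow> bool" where
  "integral_curve F \<longleftrightarrow> homogeneous F \<and> irreducible F"

definition curve_points :: "poly3 \<Rightarrow> proj_plane set" where
  "curve_points F = {p. \<forall>v \<in> cone_of p. eval3 F v = 0}"

definition curve_degree :: "poly3 \<Rightarrow> nat" where
  "curve_degree F = Max (monom_degree ` Poly_Mapping.keys F)"

text \<open>The equation of the curve in the affine chart where the \<open>i\<close>-th coordinate is 1, with the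
  point \<open>v\<close> of that chart moved to the origin.\<close>

definition local_equation :: "poly3 \<Rightarrow> 3 \<Rightarrow> complex ^ 3 \<Rightarrow> poly3" where
  "local_equation F i v = (\<Sum>m\<in>Poly_Mapping.keys F.
     Const (Poly_Mapping.lookup F m) *
     (\<Prod>j\<in>UNIV. (if j = i then 1 else Const (v $ j) + Var j) ^ Poly_Mapping.lookup m j))"

text \<open>The multiplicity is the degree of the lowest-order term of the local equation. It does not
  depend on the chart containing \<open>p\<close>; the definition picks one.\<close>

definition curve_mult :: "poly3 \<Rightarrow> proj_plane \<Rightarrow> nat" where
  "curve_mult F p =
     (let i = (SOME i. \<exists>v \<in> cone_of p. v $ i \<noteq> 0);
          v = (THE v. v \<in> cone_of p \<and> v $ i = 1)
      in Min (monom_degree ` Poly_Mapping.keys (local_equation F i v)))"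

section \<open>Multi-point Seshadri constants of the hyperplane bundle\<close>

definition seshadri :: "proj_plane set \<Rightarrow> real" where
  "seshadri P =
     (INF C \<in> {C. integral_curve C \<and> curve_points C \<inter> P \<noteq> {}}.
        real (curve_degree C) / real (\<Sum>p\<in>P. curve_mult C p))"

end

theory Submission imports Defs begin

text \<open>The lines of the arrangement compute the constant. Such a line has degree 1 and passes simply
  through exactly \<open>n + 1\<close> singular points, so its quotient is \<open>1 / (n + 1)\<close>. It remains to see that
  an integral curve \<open>C\<close> of degree \<open>d\<close> has \<open>\<Sum>\<^sub>p mult\<^sub>p C \<le> (n + 1) d\<close>, the sum being over the singular points.

  If \<open>C\<close> is not one of the lines, then by Bezout's theorem each line \<open>l\<close> gives
  \<open>\<Sum>\<^sub>p mult\<^sub>p C \<le> d\<close>, summed over the singular points on \<open>l\<close>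
  (\<open>sum_curve_mult_on_line_le_degree\<close>). Adding this over the \<open>3 n\<close> lines counts each singular point as
  often as lines pass through it, hence at least three times. This gives \<open>\<Sum>\<^sub>p mult\<^sub>p C \<le> n d\<close>, which is even
  better than needed (\<open>sum_curve_mult_le\<close>).

  Only the intersection of a curve with a line enters, and it reduces to one variable: along
  \<open>u + t w\<close> the equation of \<open>C\<close> becomes a polynomial in \<open>t\<close> of degree at most \<open>d\<close>, and a point of
  multiplicity \<open>m\<close> on the line is a root of order at least \<open>m\<close>
  (\<open>power_curve_mult_dvd_restrict_line\<close>). This polynomial is nonzero unless the equation vanishes on the
  line, in which case the linear form of the line divides it and, by irreducibility, \<open>C\<close> is the line
  (\<open>irreducible_vanishing_on_line\<close>).\<close>

section \<open>Substitution into polynomials\<close>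

text \<open>Evaluation at a point, restriction to a line, the passage to a local equation and the grading
  below are all substitutions into a polynomial along a homomorphism of coefficients. Working with
  bare functions keeps one notion for target rings as different as the complex numbers and
  polynomials over \<^typ>\<open>poly3\<close>.\<close>

definition ring_hom_fun :: "('a::comm_ring_1 \<Rightarrow> 'b::comm_ring_1) \<Rightarrow> bool" where
  "ring_hom_fun h \<longleftrightarrow> h 0 = 0 \<and> h 1 = 1 \<and>
     (\<forall>x y. h (x + y) = h x + h y) \<and> (\<forall>x y. h (x * y) = h x * h y)"

lemma ring_hom_funD:
  assumes "ring_hom_fun h"
  shows "h 0 = 0" "h 1 = 1" "h (x + y) = h x + h y" "h (x * y) = h x * h y"
  using assms by (auto simp: ring_hom_fun_def)

lemma ring_hom_fun_power: "ring_hom_fun h \<Longrightarrow> h (x ^ n) = h x ^ n"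
  by (induction n) (auto simp: ring_hom_funD)

lemma ring_hom_fun_sum: "ring_hom_fun h \<Longrightarrow> h (\<Sum>x\<in>A. f x) = (\<Sum>x\<in>A. h (f x))"
  by (induction A rule: infinite_finite_induct) (auto simp: ring_hom_funD)

lemma ring_hom_fun_prod: "ring_hom_fun h \<Longrightarrow> h (\<Prod>x\<in>A. f x) = (\<Prod>x\<in>A. h (f x))"
  by (induction A rule: infinite_finite_induct) (auto simp: ring_hom_funD)

lemma ring_hom_fun_comp: "ring_hom_fun g \<Longrightarrow> ring_hom_fun h \<Longrightarrow> ring_hom_fun (\<lambda>x. g (h x))"
  by (simp add: ring_hom_fun_def)

lemma ring_hom_fun_ident: "ring_hom_fun (\<lambda>x. x)"
  by (simp add: ring_hom_fun_def)

lemma ring_hom_fun_const_poly: "ring_hom_fun (\<lambda>c. [:c:])"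
  by (auto simp: ring_hom_fun_def one_pCons)

lemma ring_hom_fun_poly: "ring_hom_fun (\<lambda>p. poly p t)"
  by (simp add: ring_hom_fun_def)

lemma ring_hom_fun_Const: "ring_hom_fun Const"
  by (simp add: ring_hom_fun_def Const_def single_add mult_single)

definition insertion ::
    "('b::comm_ring_1 \<Rightarrow> 'a::comm_ring_1) \<Rightarrow> ('n::finite \<Rightarrow> 'a) \<Rightarrow> (('n \<Rightarrow>\<^sub>0 nat) \<Rightarrow>\<^sub>0 'b) \<Rightarrow> 'a" where
  "insertion \<kappa> g F =
     (\<Sum>m\<in>Poly_Mapping.keys F. \<kappa> (Poly_Mapping.lookup F m) * (\<Prod>i\<in>UNIV. g i ^ Poly_Mapping.lookup m i))"

lemma insertion_superset:
  assumes "ring_hom_fun \<kappa>" "finite S" "Poly_Mapping.keys F \<subseteq> S"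
  shows "insertion \<kappa> g F =
     (\<Sum>m\<in>S. \<kappa> (Poly_Mapping.lookup F m) * (\<Prod>i\<in>UNIV. g i ^ Poly_Mapping.lookup m i))"
  unfolding insertion_def
  using assms by (intro sum.mono_neutral_left) (auto simp: in_keys_iff ring_hom_funD)

lemma insertion_add:
  assumes "ring_hom_fun \<kappa>"
  shows "insertion \<kappa> g (F + G) = insertion \<kappa> g F + insertion \<kappa> g G"
proof -
  let ?S = "Poly_Mapping.keys F \<union> Poly_Mapping.keys G"
  have "Poly_Mapping.keys (F + G) \<subseteq> ?S"
    by (rule keys_add)
  then show ?thesis
    using assms
    by (simp add: insertion_superset[of \<kappa> ?S] lookup_add ring_hom_funD distrib_right sum.distrib)
qed

lemma insertion_single:
  assumes "ring_hom_fun \<kappa>"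
  shows "insertion \<kappa> g (Poly_Mapping.single m c) = \<kappa> c * (\<Prod>i\<in>UNIV. g i ^ Poly_Mapping.lookup m i)"
  using assms by (subst insertion_superset[of _ "{m}"]) auto

lemma insertion_0 [simp]: "insertion \<kappa> g 0 = 0"
  by (simp add: insertion_def)

lemma insertion_sum:
  assumes "ring_hom_fun \<kappa>"
  shows "insertion \<kappa> g (\<Sum>x\<in>A. f x) = (\<Sum>x\<in>A. insertion \<kappa> g (f x))"
  by (induction A rule: infinite_finite_induct) (auto simp: insertion_add[OF assms])

lemma poly_mapping_as_sum_of_single:
  "F = (\<Sum>m\<in>Poly_Mapping.keys F. Poly_Mapping.single m (Poly_Mapping.lookup F m))"
  by (rule poly_mapping_eqI)
     (auto simp: lookup_sum lookup_single when_def in_keys_iff sum.delta)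

lemma insertion_mult:
  fixes F G :: "('n::finite \<Rightarrow>\<^sub>0 nat) \<Rightarrow>\<^sub>0 'b::comm_ring_1"
  assumes "ring_hom_fun \<kappa>"
  shows "insertion \<kappa> g (F * G) = insertion \<kappa> g F * insertion \<kappa> g G"
proof -
  have single: "insertion \<kappa> g (Poly_Mapping.single m c * Poly_Mapping.single m' c')
      = insertion \<kappa> g (Poly_Mapping.single m c) * insertion \<kappa> g (Poly_Mapping.single m' c')"
    for m m' :: "'n \<Rightarrow>\<^sub>0 nat" and c c'
    by (simp add: mult_single insertion_single[OF assms] ring_hom_funD[OF assms] lookup_add
        power_add prod.distrib ac_simps)
  show ?thesis
    by (subst (1 2) poly_mapping_as_sum_of_single, subst (3 4) poly_mapping_as_sum_of_single)
       (simp only: sum_product insertion_sum[OF assms] single)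
qed

lemma ring_hom_fun_insertion:
  assumes "ring_hom_fun \<kappa>"
  shows "ring_hom_fun (insertion \<kappa> g)"
proof -
  have "insertion \<kappa> g 1 = 1"
    using insertion_single[OF assms, of g 0 1] by (simp add: ring_hom_funD(2)[OF assms])
  then show ?thesis
    unfolding ring_hom_fun_def
    using insertion_add[OF assms, of g] insertion_mult[OF assms, of g] by simp
qed

text \<open>The rule by which any two of the substitutions are compared: a homomorphism following a
  substitution only acts on the images of the coefficients and of the variables.\<close>

lemma hom_insertion:
  assumes "ring_hom_fun h"
  shows "h (insertion \<kappa> g F) = insertion (\<lambda>c. h (\<kappa> c)) (\<lambda>i. h (g i)) F"
  by (simp add: insertion_def ring_hom_fun_sum[OF assms] ring_hom_fun_prod[OF assms]
      ring_hom_fun_power[OF assms] ring_hom_funD(4)[OF assms])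

lemma insertion_Var:
  assumes "ring_hom_fun \<kappa>"
  shows "insertion \<kappa> g (Var i) = g i"
proof -
  have "(\<Prod>j\<in>UNIV. g j ^ Poly_Mapping.lookup (Poly_Mapping.single i 1) j)
      = (\<Prod>j\<in>UNIV. if j = i then g i else 1)"
    by (rule prod.cong) (auto simp: lookup_single)
  then show ?thesis
    by (simp add: Var_def insertion_single[OF assms] ring_hom_funD(2)[OF assms])
qed

lemma insertion_Const: "ring_hom_fun \<kappa> \<Longrightarrow> insertion \<kappa> g (Const c) = \<kappa> c"
  by (simp add: Const_def insertion_single)

lemma single_eq_Const_times_Vars:
  "Poly_Mapping.single m c = Const c * (\<Prod>i\<in>UNIV. Var i ^ Poly_Mapping.lookup m i)"
proof -
  have pow: "Var i ^ k = Poly_Mapping.single (Poly_Mapping.single i k) 1" for i k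
    by (induction k) (auto simp: Var_def mult_single single_add[symmetric])
  have "(\<Prod>i\<in>A. Var i ^ Poly_Mapping.lookup m i)
      = Poly_Mapping.single (\<Sum>i\<in>A. Poly_Mapping.single i (Poly_Mapping.lookup m i)) 1" for A
    by (induction A rule: infinite_finite_induct) (auto simp: pow mult_single)
  moreover have "(\<Sum>i\<in>UNIV. Poly_Mapping.single i (Poly_Mapping.lookup m i)) = m"
    by (rule poly_mapping_eqI) (auto simp: lookup_sum lookup_single when_def)
  ultimately show ?thesis
    by (simp add: Const_def mult_single)
qed

lemma insertion_Const_Var: "insertion Const Var F = F"
  by (subst (2) poly_mapping_as_sum_of_single)
     (simp add: insertion_def single_eq_Const_times_Vars)

section \<open>Polynomials as functions\<close>

lemma eval3_eq_insertion: "eval3 F v = insertion (\<lambda>c. c) (($) v) F"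
  by (simp add: eval3_def insertion_def)

lemma local_equation_eq_insertion:
  "local_equation F i v = insertion Const (\<lambda>j. if j = i then 1 else Const (v $ j) + Var j) F"
  by (simp add: local_equation_def insertion_def)

lemma ring_hom_fun_eval3: "ring_hom_fun (\<lambda>F. eval3 F v)"
  using ring_hom_fun_insertion[OF ring_hom_fun_ident]
  by (simp add: eval3_eq_insertion[abs_def])

lemmas eval3_hom = ring_hom_funD[OF ring_hom_fun_eval3]

lemma eval3_Const [simp]: "eval3 (Const c) v = c"
  by (simp add: eval3_eq_insertion insertion_Const ring_hom_fun_ident)

lemma eval3_Var [simp]: "eval3 (Var i) v = v $ i"
  by (simp add: eval3_eq_insertion insertion_Var ring_hom_fun_ident)

lemma eval3_insertion:
  "eval3 (insertion Const g F) v = eval3 F (\<chi> i. eval3 (g i) v)"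
  unfolding hom_insertion[OF ring_hom_fun_eval3[of v]] eval3_Const
  by (simp add: eval3_eq_insertion vec_lambda_inverse)

lemma eval3_at_0: "eval3 F 0 = Poly_Mapping.lookup F 0"
proof -
  have "(\<Prod>i\<in>UNIV. (0::complex) ^ Poly_Mapping.lookup m i) = (if m = 0 then 1 else 0)"
    for m :: monomial3
    by (auto simp: poly_mapping_eq_iff fun_eq_iff)
  then have "eval3 F 0 = (\<Sum>m\<in>Poly_Mapping.keys F. if m = 0 then Poly_Mapping.lookup F m else 0)"
    unfolding eval3_def by (intro sum.cong) auto
  then show ?thesis
    by (simp add: in_keys_iff)
qed

text \<open>Uniqueness of the digits in base \<open>N\<close>; the top digit may be arbitrarily large.\<close>

lemma kronecker_exponent_inj:
  fixes N :: nat
  assumes "a1 < N" "a2 < N" "b1 < N" "b2 < N"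
    and eq: "a1 + N * (a2 + N * a3) = b1 + N * (b2 + N * b3)"
  shows "a1 = b1 \<and> a2 = b2 \<and> a3 = b3"
proof -
  have "a1 = b1"
    using assms(1,3) arg_cong[OF eq, of "\<lambda>x. x mod N"]
    by (simp only: mod_mult_self2 mod_less)
  moreover from this have eq2: "a2 + N * a3 = b2 + N * b3"
    using eq assms(1) by (metis add_left_cancel mult_left_cancel not_less_zero neq0_conv)
  moreover have "a2 = b2"
    using assms(2,4) arg_cong[OF eq2, of "\<lambda>x. x mod N"]
    by (simp only: mod_mult_self2 mod_less)
  ultimately show ?thesis
    using assms(1) by (metis add_left_cancel mult_left_cancel not_less_zero neq0_conv)
qed

lemma prod_UNIV_3: "(\<Prod>i\<in>UNIV. f (i :: 3)) = f 1 * f 2 * f 3"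
  unfolding UNIV_3 by (simp add: ac_simps)

text \<open>Kronecker substitution: putting \<open>t\<close>, \<open>t ^ N\<close> and \<open>t ^ N\<^sup>2\<close> for the variables, with \<open>N\<close> above all
  exponents, sends distinct monomials of \<open>F\<close> to distinct powers of \<open>t\<close>. So it loses no coefficient,
  and the question becomes the one for polynomials in one variable.\<close>

lemma eval3_eq_0_imp_eq_0:
  assumes zero: "\<And>v. eval3 F v = 0"
  shows "F = 0"
proof -
  define N where "N = Suc (\<Sum>m\<in>Poly_Mapping.keys F. monom_degree m)"
  have bound: "Poly_Mapping.lookup m i < N" if "m \<in> Poly_Mapping.keys F" for m i
  proof -
    have "Poly_Mapping.lookup m i \<le> monom_degree m"
      unfolding monom_degree_def by (intro member_le_sum) auto
    also have "\<dots> \<le> (\<Sum>m\<in>Poly_Mapping.keys F. monom_degree m)"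
      using that by (intro member_le_sum) auto
    finally show ?thesis
      by (simp add: N_def)
  qed
  define e :: "monomial3 \<Rightarrow> nat" where
    "e m = Poly_Mapping.lookup m 1
       + N * (Poly_Mapping.lookup m 2 + N * Poly_Mapping.lookup m 3)" for m
  have inj: "inj_on e (Poly_Mapping.keys F)"
  proof (rule inj_onI)
    fix m m' assume "m \<in> Poly_Mapping.keys F" "m' \<in> Poly_Mapping.keys F" "e m = e m'"
    then have "Poly_Mapping.lookup m i = Poly_Mapping.lookup m' i" for i
      using kronecker_exponent_inj[of "Poly_Mapping.lookup m 1" N "Poly_Mapping.lookup m 2"
          "Poly_Mapping.lookup m' 1" "Poly_Mapping.lookup m' 2"] bound exhaust_3[of i]
      by (auto simp: e_def)
    then show "m = m'"
      by (rule poly_mapping_eqI)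
  qed
  define p where "p = (\<Sum>m\<in>Poly_Mapping.keys F. monom (Poly_Mapping.lookup F m) (e m))"
  have "poly p t = eval3 F (\<chi> i. if i = 1 then t else if i = 2 then t ^ N else t ^ (N * N))" for t
    unfolding p_def poly_sum poly_monom eval3_def prod_UNIV_3 e_def
    by (intro sum.cong refl) (simp add: power_add power_mult mult.assoc)
  then have "p = 0"
    using zero poly_all_0_iff_0[of p] by simp
  show ?thesis
  proof (rule poly_mapping_eqI, rule ccontr)
    fix m assume nz: "Poly_Mapping.lookup F m \<noteq> Poly_Mapping.lookup 0 m"
    then have m: "m \<in> Poly_Mapping.keys F"
      by (simp add: in_keys_iff)
    have "coeff p (e m) = (\<Sum>m'\<in>Poly_Mapping.keys F.
        if m' = m then Poly_Mapping.lookup F m' else 0)"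
      unfolding p_def coeff_sum
      by (intro sum.cong refl) (use inj m in \<open>auto simp: inj_on_def\<close>)
    also have "\<dots> = Poly_Mapping.lookup F m"
      using m by (simp add: sum.delta')
    finally show False
      using nz \<open>p = 0\<close> by simp
  qed
qed

lemma eval3_eqI:
  assumes "\<And>v. eval3 F v = eval3 G v"
  shows "F = G"
proof -
  have "eval3 (F - G) v = 0" for v
    using eval3_hom(3)[of "F - G" G v] assms[of v] by simp
  then show ?thesis
    using eval3_eq_0_imp_eq_0[of "F - G"] by simp
qed

section \<open>Degree, units and linear forms\<close>

lemma keys_nonempty:
  assumes "F \<noteq> 0"
  shows "Poly_Mapping.keys F \<noteq> {}"
proof
  assume "Poly_Mapping.keys F = {}"
  then have "Poly_Mapping.lookup F m = Poly_Mapping.lookup 0 m" for m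
    using in_keys_iff[of m F] by simp
  then show False
    using assms by (blast intro: poly_mapping_eqI)
qed

lemma homogeneous_monom_degree:
  assumes "homogeneous F" "m \<in> Poly_Mapping.keys F"
  shows "monom_degree m = curve_degree F"
proof -
  obtain d where d: "\<forall>m\<in>Poly_Mapping.keys F. monom_degree m = d"
    using assms(1) by (auto simp: homogeneous_def)
  then have "monom_degree ` Poly_Mapping.keys F = {d}"
    using assms(2) by auto
  then show ?thesis
    using d assms(2) by (simp add: curve_degree_def)
qed

lemma monomial_scale:
  fixes s :: "'a::comm_monoid_mult"
  shows "(\<Prod>i\<in>UNIV. (s * f i) ^ Poly_Mapping.lookup m i)
    = s ^ monom_degree m * (\<Prod>i\<in>UNIV. f i ^ Poly_Mapping.lookup m i)"
  by (simp add: power_mult_distrib prod.distrib monom_degree_def power_sum)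

lemma eval3_scale:
  assumes "homogeneous F"
  shows "eval3 F (s *s v) = s ^ curve_degree F * eval3 F v"
  unfolding eval3_def sum_distrib_left vector_smult_component monomial_scale
  by (intro sum.cong refl) (simp add: homogeneous_monom_degree[OF assms])

text \<open>The homogenisation \<open>F(T X\<^sub>1, T X\<^sub>2, T X\<^sub>3)\<close>, where \<open>T\<close> is the new polynomial variable. Its degree in \<open>T\<close> is
  the total degree of \<open>F\<close>, and multiplicativity of the total degree is inherited from that of the
  degree of polynomials over a domain.\<close>

definition grade :: "poly3 \<Rightarrow> poly3 poly" where
  "grade F = insertion (\<lambda>c. [:Const c:]) (\<lambda>i. [:0, Var i:]) F"

lemma ring_hom_fun_grade: "ring_hom_fun grade"
  using ring_hom_fun_insertion[OF ring_hom_fun_comp[OF ring_hom_fun_const_poly ring_hom_fun_Const]]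
  by (simp add: grade_def[abs_def])

lemma eval3_grade: "eval3 (poly (grade F) (Const t)) v = eval3 F (t *s v)"
proof -
  have "ring_hom_fun (\<lambda>p. eval3 (poly p (Const t)) v)"
    by (intro ring_hom_fun_comp[OF ring_hom_fun_eval3] ring_hom_fun_poly)
  then show ?thesis
    unfolding grade_def
    by (subst hom_insertion) (simp_all add: eval3_eq_insertion[of F] eval3_hom
        vector_scalar_mult_def vec_lambda_inverse)
qed

text \<open>Without a \<open>T\<close>, the values \<open>F(T v)\<close> at \<open>T = 0\<close> and at \<open>T = 1\<close> agree.\<close>

lemma degree_grade_0_imp_Const:
  assumes "degree (grade F) = 0"
  obtains c where "F = Const c"
proof
  obtain G where G: "grade F = [:G:]"
    using assms by (rule degree_eq_zeroE)
  show "F = Const (eval3 F 0)"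
  proof (rule eval3_eqI)
    fix v
    show "eval3 F v = eval3 (Const (eval3 F 0)) v"
      using eval3_grade[of F 0 v] eval3_grade[of F 1 v] by (simp add: G)
  qed
qed

lemma grade_nonzero:
  assumes "F \<noteq> 0"
  shows "grade F \<noteq> 0"
proof
  assume "grade F = 0"
  then have "eval3 F v = 0" for v
    using eval3_grade[of F 1 v] by (simp add: eval3_hom)
  then show False
    using assms eval3_eq_0_imp_eq_0 by blast
qed

lemma degree_grade_mult:
  assumes "F * G \<noteq> 0"
  shows "degree (grade (F * G)) = degree (grade F) + degree (grade G)"
  using assms by (auto simp: ring_hom_funD(4)[OF ring_hom_fun_grade] grade_nonzero degree_mult_eq)

lemma Const_dvd_1:
  assumes "c \<noteq> 0"
  shows "Const c dvd 1"
proof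
  show "1 = Const c * Const (inverse c)"
    using assms by (simp add: Const_def mult_single)
qed

lemma unit_imp_Const:
  assumes "F dvd (1 :: poly3)"
  obtains c where "c \<noteq> 0" "F = Const c"
proof -
  obtain G where G: "1 = F * G"
    using assms by (elim dvdE)
  have "degree (grade F) + degree (grade G) = degree (grade 1)"
    using degree_grade_mult[of F G] G by simp
  also have "\<dots> = 0"
    by (simp add: ring_hom_funD(2)[OF ring_hom_fun_grade])
  finally obtain c where c: "F = Const c"
    by (auto intro: degree_grade_0_imp_Const)
  moreover have "c \<noteq> 0"
    using arg_cong[OF G, of "\<lambda>H. eval3 H 0"] by (auto simp: c eval3_hom)
  ultimately show thesis
    using that by blast
qed

definition linear_form :: "complex ^ 3 \<Rightarrow> poly3" where
  "linear_form a = (\<Sum>i\<in>UNIV. Const (a $ i) * Var i)"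

lemma eval3_linear_form [simp]: "eval3 (linear_form a) v = (\<Sum>i\<in>UNIV. a $ i * v $ i)"
  by (simp add: linear_form_def ring_hom_fun_sum[OF ring_hom_fun_eval3] eval3_hom)

lemma linear_form_nonzero:
  assumes "a \<noteq> 0"
  shows "linear_form a \<noteq> 0"
proof
  assume *: "linear_form a = 0"
  have "a $ i = 0" for i
    using arg_cong[OF *, of "\<lambda>F. eval3 F (axis i 1)"]
    by (simp add: eval3_hom axis_def if_distrib cong: if_cong)
  then show False
    using assms by (simp add: vec_eq_iff)
qed

lemma monom_degree_single: "monom_degree (Poly_Mapping.single i k) = k"
  by (simp add: monom_degree_def lookup_single when_def)

lemma keys_linear_form:
  assumes "m \<in> Poly_Mapping.keys (linear_form a)"
  shows "monom_degree m = 1"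
proof -
  have "(\<Sum>i\<in>UNIV. Poly_Mapping.lookup (Poly_Mapping.single (Poly_Mapping.single i 1) (a $ i)) m) \<noteq> 0"
    using assms by (simp add: linear_form_def Const_def Var_def mult_single lookup_sum in_keys_iff)
  then obtain i where
    "Poly_Mapping.lookup (Poly_Mapping.single (Poly_Mapping.single i 1) (a $ i)) m \<noteq> 0"
    by (rule sum.not_neutral_contains_not_neutral)
  then have "m = Poly_Mapping.single i 1"
    by (auto simp: lookup_single when_def split: if_splits)
  then show ?thesis
    by (simp add: monom_degree_single)
qed

lemma homogeneous_linear_form: "homogeneous (linear_form a)"
  unfolding homogeneous_def using keys_linear_form by blast

lemma curve_degree_linear_form:
  assumes "a \<noteq> 0"
  shows "curve_degree (linear_form a) = 1"
proof -
  obtain m where "m \<in> Poly_Mapping.keys (linear_form a)"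
    using keys_nonempty[OF linear_form_nonzero[OF assms]] by blast
  then show ?thesis
    using homogeneous_monom_degree[OF homogeneous_linear_form] keys_linear_form by simp
qed

lemma grade_linear_form: "grade (linear_form a) = [:0, linear_form a:]"
proof -
  have sum: "(\<Sum>i\<in>A. [:0, Var i * Const (a $ i):]) = [:0, \<Sum>i\<in>A. Const (a $ i) * Var i:]" for A
    by (induction A rule: infinite_finite_induct) (auto simp: mult.commute)
  have hom: "ring_hom_fun (\<lambda>c. [:Const c:])"
    by (intro ring_hom_fun_comp[OF ring_hom_fun_const_poly] ring_hom_fun_Const)
  show ?thesis
    by (simp add: grade_def linear_form_def insertion_sum[OF hom] insertion_mult[OF hom]
        insertion_Const[OF hom] insertion_Var[OF hom] sum)
qed

text \<open>The total degrees of two factors add up to 1, so one factor is a constant.\<close>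

lemma irreducible_linear_form:
  assumes "a \<noteq> 0"
  shows "irreducible (linear_form a)"
proof (rule irreducibleI)
  show nz: "linear_form a \<noteq> 0"
    using assms by (rule linear_form_nonzero)
  show "\<not> linear_form a dvd 1"
  proof
    assume "linear_form a dvd 1"
    then obtain c where c: "c \<noteq> 0" "linear_form a = Const c"
      by (rule unit_imp_Const)
    have "eval3 (linear_form a) 0 = c"
      by (simp only: c(2) eval3_Const)
    then show False
      using c(1) by simp
  qed
  fix F G assume FG: "linear_form a = F * G"
  then have "degree (grade F) + degree (grade G) = 1"
    using degree_grade_mult[of F G] nz by (simp add: grade_linear_form flip: FG)
  then consider "degree (grade F) = 0" | "degree (grade G) = 0"
    by linarith
  then show "F dvd 1 \<or> G dvd 1"
  proof cases
    case 1
    then obtain c where "F = Const c"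
      by (rule degree_grade_0_imp_Const)
    then show ?thesis
      using nz FG Const_dvd_1[of c] by (cases "c = 0") (auto simp: ring_hom_funD(1)[OF ring_hom_fun_Const])
  next
    case 2
    then obtain c where "G = Const c"
      by (rule degree_grade_0_imp_Const)
    then show ?thesis
      using nz FG Const_dvd_1[of c] by (cases "c = 0") (auto simp: ring_hom_funD(1)[OF ring_hom_fun_Const])
  qed
qed

text \<open>Solving \<open>a \<bullet> X = 0\<close> for a variable \<open>X\<^sub>k\<close> with \<open>a\<^sub>k \<noteq> 0\<close> expresses each variable as \<open>g i\<close> modulo the
  linear form \<open>A\<close>. With a new variable \<open>T\<close> in place of \<open>A\<close>, the substitution \<open>X\<^sub>i \<mapsto> g i + q\<^sub>i T\<close> yields a
  polynomial \<open>p\<close> in \<open>T\<close> with \<open>p(A) = F\<close>. Its constant term \<open>p(0)\<close> has at each point the value of \<open>F\<close> at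
  a point of the plane \<open>a \<bullet> v = 0\<close>, so it vanishes, and \<open>A\<close> divides \<open>p(A) - p(0)\<close>.\<close>

lemma linear_form_dvd_of_vanishing:
  assumes a: "a \<noteq> 0"
    and zero: "\<And>v. (\<Sum>i\<in>UNIV. a $ i * v $ i) = 0 \<Longrightarrow> eval3 F v = 0"
  shows "linear_form a dvd F"
proof -
  obtain k where k: "a $ k \<noteq> 0"
    using a by (auto simp: vec_eq_iff)
  let ?A = "linear_form a"
  define g where "g i = (if i = k then Var k - Const (inverse (a $ k)) * ?A else Var i)" for i
  define h where "h i = [:g i, if i = k then Const (inverse (a $ k)) else 0:]" for i
  define p where "p = insertion (\<lambda>c. [:Const c:]) h F"
  have hom: "ring_hom_fun (\<lambda>q. poly q x)" for x :: poly3
    by (rule ring_hom_fun_poly)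
  have pA: "poly p ?A = F"
  proof -
    have "poly (h i) ?A = Var i" for i
      by (simp add: h_def g_def mult.commute)
    then show ?thesis
      by (simp add: p_def hom_insertion[OF hom] insertion_Const_Var)
  qed
  have "poly p 0 = 0"
  proof (rule eval3_eq_0_imp_eq_0)
    fix v
    have diff: "eval3 (G - H) v = eval3 G v - eval3 H v" for G H
      using eval3_hom(3)[of "G - H" H v] by simp
    let ?u = "\<chi> i. eval3 (g i) v"
    have u: "?u $ i = v $ i - (if i = k then inverse (a $ k) * (\<Sum>i\<in>UNIV. a $ i * v $ i) else 0)" for i
      by (simp add: g_def diff eval3_hom)
    have "a $ i * ?u $ i = a $ i * v $ i - (if i = k then \<Sum>i\<in>UNIV. a $ i * v $ i else 0)" for i
      unfolding u using k by (simp add: right_diff_distrib)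
    then have "(\<Sum>i\<in>UNIV. a $ i * ?u $ i) = 0"
      by (simp only: sum_subtractf) simp
    then have "eval3 F ?u = 0"
      by (rule zero)
    then show "eval3 (poly p 0) v = 0"
      by (simp add: p_def hom_insertion[OF hom] h_def eval3_insertion)
  qed
  then have "F = ?A * poly (synthetic_div p 0) ?A"
    using arg_cong[OF synthetic_div_correct[of p 0], of "\<lambda>q. poly q ?A"] pA by simp
  then show ?thesis
    by (rule dvdI)
qed

text \<open>The exceptional case in which intersecting with a line gives no bound: the curve is that line.\<close>

lemma irreducible_vanishing_on_line:
  assumes "irreducible F" "a \<noteq> 0"
    and "\<And>v. (\<Sum>i\<in>UNIV. a $ i * v $ i) = 0 \<Longrightarrow> eval3 F v = 0"
  obtains c where "c \<noteq> 0" "F = Const c * linear_form a"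
proof -
  have "linear_form a dvd F"
    using assms(2,3) by (intro linear_form_dvd_of_vanishing)
  then obtain Q where Q: "F = linear_form a * Q"
    by (elim dvdE)
  have "\<not> linear_form a dvd 1"
    using irreducible_linear_form[OF assms(2)] by (simp add: irreducible_def)
  then have "Q dvd 1"
    using assms(1) Q by (auto simp: irreducible_def)
  then obtain c where "c \<noteq> 0" "Q = Const c"
    by (rule unit_imp_Const)
  then show thesis
    using that Q by (simp add: mult.commute)
qed

section \<open>Restriction to a line\<close>

text \<open>The equation of \<open>F\<close> on the affine line through \<open>v\<close> with direction \<open>w\<close>, in the coordinate \<open>t\<close> of
  \<open>v + t w\<close>.\<close>

definition restrict_line :: "poly3 \<Rightarrow> complex ^ 3 \<Rightarrow> complex ^ 3 \<Rightarrow> complex poly" where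
  "restrict_line F v w = insertion (\<lambda>c. [:c:]) (\<lambda>i. [:v $ i, w $ i:]) F"

lemma poly_restrict_line: "poly (restrict_line F v w) t = eval3 F (v + t *s w)"
proof -
  have "(\<lambda>i. v $ i + t * w $ i) = ($) (v + t *s w)"
    by (simp add: fun_eq_iff)
  then show ?thesis
    by (simp add: restrict_line_def hom_insertion[OF ring_hom_fun_poly] eval3_eq_insertion)
qed

lemma degree_restrict_line: "degree (restrict_line F v w) \<le> curve_degree F"
  unfolding restrict_line_def insertion_def
proof (rule degree_sum_le)
  fix m assume m: "m \<in> Poly_Mapping.keys F"
  have "degree ([:Poly_Mapping.lookup F m:] * (\<Prod>i\<in>UNIV. [:v $ i, w $ i:] ^ Poly_Mapping.lookup m i))
      \<le> degree (\<Prod>i\<in>UNIV. [:v $ i, w $ i:] ^ Poly_Mapping.lookup m i)"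
    using degree_smult_le by simp
  also have "\<dots> \<le> (\<Sum>i\<in>UNIV. degree ([:v $ i, w $ i:] ^ Poly_Mapping.lookup m i))"
    using degree_prod_sum_le[of "UNIV :: 3 set" "\<lambda>i. [:v $ i, w $ i:] ^ Poly_Mapping.lookup m i"]
    by (simp add: comp_def)
  also have "\<dots> \<le> monom_degree m"
    unfolding monom_degree_def
    by (intro sum_mono order.trans[OF degree_power_le]) auto
  also have "\<dots> \<le> curve_degree F"
    unfolding curve_degree_def using m by (intro Max_ge) auto
  finally show "degree ([:Poly_Mapping.lookup F m:]
      * (\<Prod>i\<in>UNIV. [:v $ i, w $ i:] ^ Poly_Mapping.lookup m i)) \<le> curve_degree F" .
qed simp

lemma poly_ext:
  fixes p q :: "complex poly"
  assumes "\<And>t. poly p t = poly q t"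
  shows "p = q"
  using assms poly_eq_poly_eq_iff[of p q] by (simp add: fun_eq_iff)

section \<open>Points of the plane and multiplicities\<close>

lemma cone_of_nonzero_eq:
  assumes "v \<in> cone_of p" "v \<noteq> 0"
  shows "cone_of p = range (\<lambda>k. k *s v)"
proof -
  obtain u where u: "cone_of p = range (\<lambda>k. k *s u)"
    using cone_of[of p] by (auto simp: vec.span_singleton)
  obtain c where c: "v = c *s u"
    using assms(1) u by auto
  with assms(2) have "c \<noteq> 0"
    by auto
  then have "k *s u = (k / c) *s v" for k
    by (simp add: c vector_smult_assoc)
  then have "cone_of p \<subseteq> range (\<lambda>k. k *s v)"
    unfolding u by blast
  moreover have "k *s v = (k * c) *s u" for k
    by (simp add: c vector_smult_assoc)
  then have "range (\<lambda>k. k *s v) \<subseteq> cone_of p"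
    unfolding u by blast
  ultimately show ?thesis
    by blast
qed

lemma cone_of_has_nonzero:
  obtains v where "v \<in> cone_of p" "v \<noteq> 0"
proof -
  obtain u where "u \<noteq> 0" "cone_of p = vec.span {u}"
    using cone_of[of p] by auto
  then show thesis
    using that vec.span_base[of u "{u}"] by auto
qed

lemma proj_point_eqI:
  assumes "v \<in> cone_of p" "v \<in> cone_of q" "v \<noteq> 0"
  shows "p = q"
  using assms cone_of_nonzero_eq by (metis cone_of_inject)

text \<open>The arguments below work in every chart that contains \<open>p\<close>, so all they use of the choices made in
  \<^const>\<open>curve_mult\<close> is that some chart was taken.\<close>

lemma curve_mult_chart:
  obtains i v where "v \<in> cone_of p" "v $ i = 1"
    "curve_mult F p = Min (monom_degree ` Poly_Mapping.keys (local_equation F i v))"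
proof -
  define i where "i = (SOME i. \<exists>v \<in> cone_of p. v $ i \<noteq> 0)"
  define v where "v = (THE v. v \<in> cone_of p \<and> v $ i = 1)"
  obtain v0 where "v0 \<in> cone_of p" "v0 \<noteq> 0"
    by (rule cone_of_has_nonzero)
  then have "\<exists>i. \<exists>v \<in> cone_of p. v $ i \<noteq> 0"
    by (auto simp: vec_eq_iff)
  then have "\<exists>v \<in> cone_of p. v $ i \<noteq> 0"
    unfolding i_def by (rule someI_ex)
  then obtain u where u: "u \<in> cone_of p" "u $ i \<noteq> 0"
    by blast
  then have cone: "cone_of p = range (\<lambda>k. k *s u)"
    by (intro cone_of_nonzero_eq) auto
  have "v \<in> cone_of p \<and> v $ i = 1"
    unfolding v_def
  proof (rule theI)
    show "inverse (u $ i) *s u \<in> cone_of p \<and> (inverse (u $ i) *s u) $ i = 1"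
      unfolding cone using u(2) by (intro conjI rangeI) simp
    fix w assume w: "w \<in> cone_of p \<and> w $ i = 1"
    then obtain k where "w = k *s u"
      unfolding cone by blast
    moreover from this have "k * u $ i = 1"
      using w by simp
    ultimately show "w = inverse (u $ i) *s u"
      using u(2) by (simp add: field_simps)
  qed
  moreover have "curve_mult F p = Min (monom_degree ` Poly_Mapping.keys (local_equation F i v))"
    by (simp add: curve_mult_def Let_def i_def v_def)
  ultimately show thesis
    using that by blast
qed

text \<open>The condition on \<open>x\<close> says that \<open>v + x\<close> stays in the chart.\<close>

lemma eval3_local_equation:
  assumes "v $ i = 1" "x $ i = 0"
  shows "eval3 (local_equation F i v) x = eval3 F (v + x)"
proof -
  have "(\<chi> j. eval3 (if j = i then 1 else Const (v $ j) + Var j) x) = v + x"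
    using assms by (auto simp: vec_eq_iff eval3_hom)
  then show ?thesis
    by (simp add: local_equation_eq_insertion eval3_insertion)
qed

lemma power_dvd_cancel_right:
  fixes p q :: "complex poly"
  assumes dvd: "[:0, 1:] ^ k dvd p * q" and q: "poly q 0 \<noteq> 0"
  shows "[:0, 1:] ^ k dvd p"
proof (cases "p = 0")
  case False
  moreover have "q \<noteq> 0"
    using q by auto
  ultimately have nz: "p * q \<noteq> 0"
    by simp
  then have "k \<le> order 0 (p * q)"
    using dvd order_divides[of 0 k "p * q"] by simp
  also have "\<dots> = order 0 p"
    using order_mult[OF nz, of 0] order_0I[OF q] by simp
  finally show ?thesis
    using order_divides[of 0 k p] by simp
qed simp

text \<open>The line \<open>v + s w\<close> leaves the chart where the \<open>i\<close>-th coordinate is 1. Dividing by that coordinate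
  \<open>c = 1 + s w\<^sub>i\<close> moves it back to \<open>v + (s / c) w'\<close>, where \<open>w'\<close> has \<open>i\<close>-th coordinate 0, and homogeneity of
  \<open>F\<close> controls the scaling. On the rescaled line the local equation is a sum of terms in powers
  \<open>(s / c) ^ j\<close> with \<open>j \<ge> k\<close>. Since \<open>c\<close> does not vanish at \<open>s = 0\<close>, clearing its powers does not affect the
  divisibility by \<open>s ^ k\<close>.\<close>

lemma power_dvd_restrict_line_chart:
  assumes hom: "homogeneous F" and v: "v $ i = 1"
    and k: "\<And>m. m \<in> Poly_Mapping.keys (local_equation F i v) \<Longrightarrow> k \<le> monom_degree m"
  shows "[:0, 1:] ^ k dvd restrict_line F v w"
proof -
  let ?G = "local_equation F i v"
  let ?d = "curve_degree F"
  define w' where "w' = w - w $ i *s v"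
  define c where "c = [:1, w $ i:]"
  define M where "M = (\<Sum>m\<in>Poly_Mapping.keys ?G. monom_degree m)"
  define a where "a m = Poly_Mapping.lookup ?G m * (\<Prod>j\<in>UNIV. w' $ j ^ Poly_Mapping.lookup m j)" for m
  define R where "R = (\<Sum>m\<in>Poly_Mapping.keys ?G.
      smult (a m) ([:0, 1:] ^ monom_degree m * c ^ (M - monom_degree m)))"
  have M: "monom_degree m \<le> M" if "m \<in> Poly_Mapping.keys ?G" for m
    unfolding M_def using that by (intro member_le_sum) auto
  \<comment> \<open>The spare factor \<open>c\<close> on both sides makes the identity hold also at the zero of \<open>c\<close>, where
    the rescaling is not possible.\<close>
  have eq: "restrict_line F v w * c ^ Suc M = R * c ^ Suc ?d"
  proof (rule poly_ext)
    fix s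
    let ?c = "1 + s * w $ i"
    have c: "poly c s = ?c"
      by (simp add: c_def)
    show "poly (restrict_line F v w * c ^ Suc M) s = poly (R * c ^ Suc ?d) s"
    proof (cases "?c = 0")
      case True
      then show ?thesis
        by (simp add: c)
    next
      case False
      have "v + s *s w = ?c *s (v + (s / ?c) *s w')"
      proof -
        have cancel: "?c * (s / ?c * y) = s * y" for y
          using False by simp
        show ?thesis
          unfolding vec_eq_iff vector_add_component vector_smult_component distrib_left[of ?c] cancel
          by (simp add: w'_def algebra_simps)
      qed
      then have "poly (restrict_line F v w) s = ?c ^ ?d * eval3 F (v + (s / ?c) *s w')"
        by (simp only: poly_restrict_line eval3_scale[OF hom])
      also have "eval3 F (v + (s / ?c) *s w') = eval3 ?G ((s / ?c) *s w')"
        using v by (subst eval3_local_equation) (auto simp: w'_def)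
      also have "\<dots> = (\<Sum>m\<in>Poly_Mapping.keys ?G. a m * (s / ?c) ^ monom_degree m)"
        unfolding eval3_def vector_smult_component monomial_scale a_def by (simp add: mult_ac)
      finally have "poly (restrict_line F v w) s * ?c ^ M
          = ?c ^ ?d * (\<Sum>m\<in>Poly_Mapping.keys ?G. a m * ((s / ?c) ^ monom_degree m * ?c ^ M))"
        by (simp only: sum_distrib_right mult.assoc)
      also have "(\<Sum>m\<in>Poly_Mapping.keys ?G. a m * ((s / ?c) ^ monom_degree m * ?c ^ M)) = poly R s"
        unfolding R_def poly_sum
      proof (rule sum.cong[OF refl])
        fix m assume "m \<in> Poly_Mapping.keys ?G"
        then have "?c ^ M = ?c ^ monom_degree m * ?c ^ (M - monom_degree m)"
          using M by (simp flip: power_add)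
        then show "a m * ((s / ?c) ^ monom_degree m * ?c ^ M)
            = poly (smult (a m) ([:0, 1:] ^ monom_degree m * c ^ (M - monom_degree m))) s"
          using False by (simp add: c power_divide)
      qed
      finally show ?thesis
        by (simp add: c mult_ac)
    qed
  qed
  have "[:0, 1:] ^ k dvd R"
    unfolding R_def
    by (intro dvd_sum dvd_smult dvd_mult2 le_imp_power_dvd k)
  then have dvd: "[:0, 1:] ^ k dvd restrict_line F v w * c ^ Suc M"
    unfolding eq by (rule dvd_mult2)
  then show ?thesis
    by (rule power_dvd_cancel_right) (simp add: c_def)
qed

text \<open>Rescaling the representative of \<open>p\<close> on the line to the one with \<open>i\<close>-th coordinate 1, and moving the
  parameter of \<open>p\<close> to 0, reduces the claim to a line through the origin of the local chart. This bounds
  the intersection multiplicity of the curve with the line from below.\<close>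

lemma power_curve_mult_dvd_restrict_line:
  assumes hom: "homogeneous F" and p: "u + t *s w \<in> cone_of p" "u + t *s w \<noteq> 0"
  shows "[:- t, 1:] ^ curve_mult F p dvd restrict_line F u w"
proof -
  obtain i v where v: "v \<in> cone_of p" "v $ i = 1"
    and mult: "curve_mult F p = Min (monom_degree ` Poly_Mapping.keys (local_equation F i v))"
    by (rule curve_mult_chart)
  obtain c where c: "v = c *s (u + t *s w)"
    using v(1) cone_of_nonzero_eq[OF p] by auto
  have "c \<noteq> 0"
    using c v(2) by auto
  have "[:0, 1:] ^ curve_mult F p dvd restrict_line F v (c *s w)"
    using hom v(2) by (rule power_dvd_restrict_line_chart) (simp add: mult)
  then obtain q where q: "restrict_line F v (c *s w) = [:0, 1:] ^ curve_mult F p * q"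
    by (elim dvdE)
  have "smult (c ^ curve_degree F) (restrict_line F u w)
      = [:- t, 1:] ^ curve_mult F p * pcompose q [:- t, 1:]"
  proof (rule poly_ext)
    fix s
    have "v + (s - t) *s (c *s w) = c *s (u + s *s w)"
      by (simp add: c vec_eq_iff algebra_simps)
    then have "poly (smult (c ^ curve_degree F) (restrict_line F u w)) s
        = poly (restrict_line F v (c *s w)) (s - t)"
      by (simp only: poly_smult poly_restrict_line eval3_scale[OF hom])
    then show "poly (smult (c ^ curve_degree F) (restrict_line F u w)) s
        = poly ([:- t, 1:] ^ curve_mult F p * pcompose q [:- t, 1:]) s"
      by (simp add: q poly_pcompose)
  qed
  then have "[:- t, 1:] ^ curve_mult F p dvd smult (c ^ curve_degree F) (restrict_line F u w)"
    by simp
  then show ?thesis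
    using \<open>c \<noteq> 0\<close> by (simp add: dvd_smult_iff)
qed

text \<open>The constant term of the local equation is the value of \<open>F\<close> at the point. The minimum that defines
  the multiplicity is taken over a nonempty set: a form that vanishes on a whole chart, times the
  coordinate of that chart, vanishes everywhere.\<close>

lemma curve_mult_pos:
  assumes hom: "homogeneous F" and "F \<noteq> 0" and p: "p \<in> curve_points F"
  shows "curve_mult F p > 0"
proof -
  obtain i v where v: "v \<in> cone_of p" "v $ i = 1"
    and mult: "curve_mult F p = Min (monom_degree ` Poly_Mapping.keys (local_equation F i v))"
    by (rule curve_mult_chart)
  let ?G = "local_equation F i v"
  have "?G \<noteq> 0"
  proof
    assume G: "?G = 0"
    have "eval3 (Var i * F) x = 0" for x
    proof (cases "x $ i = 0")
      case False
      let ?y = "inverse (x $ i) *s x"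
      have "eval3 F ?y = eval3 ?G (?y - v)"
        using False v(2) by (subst eval3_local_equation) auto
      moreover have "x = x $ i *s ?y"
        using False by (simp add: vector_smult_assoc)
      ultimately show ?thesis
        using eval3_scale[OF hom, of "x $ i" ?y] G by (simp add: eval3_hom)
    qed (simp add: eval3_hom)
    then have "Var i * F = 0"
      by (rule eval3_eq_0_imp_eq_0)
    moreover have "Var i \<noteq> 0"
    proof
      assume "Var i = 0"
      then have "eval3 (Var i) v = 0"
        by (simp only: eval3_hom)
      then show False
        using v(2) by simp
    qed
    ultimately show False
      using \<open>F \<noteq> 0\<close> by simp
  qed
  then have "Poly_Mapping.keys ?G \<noteq> {}"
    by (rule keys_nonempty)
  then have "Min (monom_degree ` Poly_Mapping.keys ?G) \<in> monom_degree ` Poly_Mapping.keys ?G"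
    by (intro Min_in) auto
  then obtain m where m: "m \<in> Poly_Mapping.keys ?G" "curve_mult F p = monom_degree m"
    using mult by auto
  have "eval3 ?G 0 = eval3 F v"
    using v(2) by (subst eval3_local_equation) auto
  also have "\<dots> = 0"
    using p v(1) by (simp add: curve_points_def)
  finally have "m \<noteq> 0"
    using m(1) by (auto simp: eval3_at_0 in_keys_iff)
  then obtain j where "Poly_Mapping.lookup m j \<noteq> 0"
    by (auto simp: poly_mapping_eq_iff fun_eq_iff)
  then show ?thesis
    by (auto simp: m(2) monom_degree_def intro!: sum_pos2[of UNIV j])
qed

section \<open>Intersection with a line\<close>

text \<open>The line is described with \<^const>\<open>eval3\<close> rather than with an explicit sum, so that it is
  literally the point set of the curve \<^term>\<open>linear_form a\<close>.\<close>

definition line_of :: "complex ^ 3 \<Rightarrow> proj_plane set" where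
  "line_of a = {p. \<forall>v \<in> cone_of p. eval3 (linear_form a) v = 0}"

lemma proj_line_iff: "proj_line l \<longleftrightarrow> (\<exists>a. a \<noteq> 0 \<and> l = line_of a)"
  by (simp add: proj_line_def line_of_def)

lemma curve_points_linear_form: "curve_points (linear_form a) = line_of a"
  by (simp add: curve_points_def line_of_def)

lemma mem_line_of_iff:
  assumes "v \<in> cone_of p" "v \<noteq> 0"
  shows "p \<in> line_of a \<longleftrightarrow> eval3 (linear_form a) v = 0"
proof -
  have "eval3 (linear_form a) (k *s v) = k * eval3 (linear_form a) v" for k
    by (simp add: sum_distrib_left mult_ac)
  then show ?thesis
    unfolding line_of_def mem_Collect_eq cone_of_nonzero_eq[OF assms]
    by (auto simp del: eval3_linear_form dest: spec[of _ 1])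
qed

lemma plane_basis:
  assumes "a \<noteq> 0"
  obtains b c where
    "\<And>v. eval3 (linear_form a) v = 0 \<longleftrightarrow> (\<exists>\<alpha> \<beta>. v = \<alpha> *s b + \<beta> *s c)"
    "\<And>\<alpha> \<beta>. \<alpha> *s b + \<beta> *s c = 0 \<Longrightarrow> \<alpha> = 0 \<and> \<beta> = 0"
proof -
  obtain k where k: "a $ k \<noteq> 0"
    using assms by (auto simp: vec_eq_iff)
  have "\<exists>i j :: 3. k \<noteq> i \<and> k \<noteq> j \<and> i \<noteq> j"
    using exhaust_3[of k]
    by (elim disjE) (rule exI[of _ 2] exI[of _ 1], rule exI[of _ 3] exI[of _ 2], simp)+
  then obtain i j :: 3 where ij: "k \<noteq> i" "k \<noteq> j" "i \<noteq> j"
    by blast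
  have "card {k, i, j} = CARD(3)"
    using ij by simp
  then have UNIV: "UNIV = {k, i, j}"
    by (metis card_subset_eq finite top_greatest)
  have all: "(\<forall>x. P x) \<longleftrightarrow> P k \<and> P i \<and> P j" for P
    using UNIV by (metis UNIV_I empty_iff insert_iff)
  have form: "eval3 (linear_form a) v = a $ k * v $ k + a $ i * v $ i + a $ j * v $ j" for v
    using ij by (simp add: UNIV)
  define b where "b = axis i 1 - (a $ i / a $ k) *s axis k 1"
  define c where "c = axis j 1 - (a $ j / a $ k) *s axis k 1"
  have coord: "(\<alpha> *s b + \<beta> *s c) $ i = \<alpha>" "(\<alpha> *s b + \<beta> *s c) $ j = \<beta>"
    "a $ k * (\<alpha> *s b + \<beta> *s c) $ k = - (a $ i * \<alpha> + a $ j * \<beta>)" for \<alpha> \<beta>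
    using k ij by (auto simp: b_def c_def axis_def field_simps)
  show thesis
  proof
    fix v
    show "eval3 (linear_form a) v = 0 \<longleftrightarrow> (\<exists>\<alpha> \<beta>. v = \<alpha> *s b + \<beta> *s c)"
    proof
      assume "eval3 (linear_form a) v = 0"
      then have "a $ k * v $ k = a $ k * (v $ i *s b + v $ j *s c) $ k"
        unfolding coord form by (simp only: eq_neg_iff_add_eq_0 add.assoc)
      then have "v $ k = (v $ i *s b + v $ j *s c) $ k"
        using k by simp
      then have "v = v $ i *s b + v $ j *s c"
        unfolding vec_eq_iff all coord by simp
      then show "\<exists>\<alpha> \<beta>. v = \<alpha> *s b + \<beta> *s c"
        by blast
    next
      assume "\<exists>\<alpha> \<beta>. v = \<alpha> *s b + \<beta> *s c"
      then show "eval3 (linear_form a) v = 0"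
        unfolding form by (elim exE) (simp only: coord, simp)
    qed
  next
    fix \<alpha> \<beta> assume "\<alpha> *s b + \<beta> *s c = 0"
    then show "\<alpha> = 0 \<and> \<beta> = 0"
      using coord[of \<alpha> \<beta>] by (metis zero_index)
  qed
qed

text \<open>The affine parametrisation \<open>u + t w\<close> misses exactly the point of the line spanned by \<open>w\<close>. A line has
  infinitely many points, so this point can be kept away from a given finite set.\<close>

lemma line_parametrisation:
  assumes "a \<noteq> 0" "finite S"
  obtains u w where
    "\<And>v. eval3 (linear_form a) v = 0 \<longleftrightarrow> (\<exists>\<alpha> \<beta>. v = \<alpha> *s u + \<beta> *s w)"
    "\<And>t. u + t *s w \<noteq> 0"
    "\<And>p. p \<in> S \<Longrightarrow> w \<notin> cone_of p"
proof -
  obtain b c where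
    plane: "\<And>v. eval3 (linear_form a) v = 0 \<longleftrightarrow> (\<exists>\<alpha> \<beta>. v = \<alpha> *s b + \<beta> *s c)"
    and indep: "\<And>\<alpha> \<beta>. \<alpha> *s b + \<beta> *s c = 0 \<Longrightarrow> \<alpha> = 0 \<and> \<beta> = 0"
    using plane_basis[OF assms(1)] by metis
  \<comment> \<open>Different \<open>s\<close> give different points, as \<open>b\<close> and \<open>c\<close> are independent.\<close>
  have "\<exists>s. \<forall>p\<in>S. c + s *s b \<notin> cone_of p"
  proof (rule ccontr)
    assume "\<nexists>s. \<forall>p\<in>S. c + s *s b \<notin> cone_of p"
    then obtain P where P: "\<And>s. P s \<in> S" "\<And>s. c + s *s b \<in> cone_of (P s)"
      by metis
    have "inj P"
    proof (rule injI)
      fix s s' assume eq: "P s = P s'"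
      have "c + s *s b \<noteq> 0"
        using indep[of s 1] by (auto simp: add.commute)
      then have "cone_of (P s) = range (\<lambda>k. k *s (c + s *s b))"
        by (intro cone_of_nonzero_eq P)
      then obtain k where "c + s' *s b = k *s (c + s *s b)"
        using P(2)[of s'] eq by auto
      then have "(s' - k * s) *s b + (1 - k) *s c = 0"
        by (simp add: vec_eq_iff algebra_simps)
      then show "s = s'"
        using indep by fastforce
    qed
    moreover have "finite (range P)"
      using P(1) by (intro finite_subset[OF _ assms(2)]) auto
    ultimately show False
      using finite_imageD infinite_UNIV_char_0 by blast
  qed
  then obtain s where s: "\<And>p. p \<in> S \<Longrightarrow> c + s *s b \<notin> cone_of p"
    by blast
  show thesis
  proof
    fix v
    have "\<alpha> *s b + \<beta> *s c = (\<alpha> - \<beta> * s) *s b + \<beta> *s (c + s *s b)"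
      and "\<alpha> *s b + \<beta> *s (c + s *s b) = (\<alpha> + \<beta> * s) *s b + \<beta> *s c" for \<alpha> \<beta>
      by (simp_all add: vec_eq_iff algebra_simps)
    then show "eval3 (linear_form a) v = 0 \<longleftrightarrow> (\<exists>\<alpha> \<beta>. v = \<alpha> *s b + \<beta> *s (c + s *s b))"
      unfolding plane by metis
    fix t
    have eq: "b + t *s (c + s *s b) = (1 + t * s) *s b + t *s c"
      by (simp add: vec_eq_iff algebra_simps)
    show "b + t *s (c + s *s b) \<noteq> 0"
    proof
      assume "b + t *s (c + s *s b) = 0"
      then have "1 + t * s = 0 \<and> t = 0"
        unfolding eq by (rule indep)
      then show False
        by auto
    qed
  qed (rule s)
qed

text \<open>The part of Bezout's theorem for a curve and a line that counts given points with the multiplicities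
  of the curve. If all the points lie on the affine part \<open>u + t w\<close> of the line, then each contributes
  a root of order at least its multiplicity to the restriction of \<open>F\<close>, and the orders of the roots
  sum to at most the degree.\<close>

lemma sum_curve_mult_on_line_le_degree:
  assumes hom: "homogeneous F" and "a \<noteq> 0" and S: "finite S"
    and v: "eval3 (linear_form a) v = 0" "eval3 F v \<noteq> 0"
  shows "(\<Sum>p\<in>S \<inter> line_of a. curve_mult F p) \<le> curve_degree F"
proof -
  obtain u w where
    plane: "\<And>v. eval3 (linear_form a) v = 0 \<longleftrightarrow> (\<exists>\<alpha> \<beta>. v = \<alpha> *s u + \<beta> *s w)"
    and nz: "\<And>t. u + t *s w \<noteq> 0"
    and w: "\<And>p. p \<in> S \<Longrightarrow> w \<notin> cone_of p"
    using line_parametrisation[OF \<open>a \<noteq> 0\<close> S] by metis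
  define f where "f = restrict_line F u w"
  have "f \<noteq> 0"
  proof
    assume "f = 0"
    then have zero: "eval3 F (u + t *s w) = 0" for t
      using poly_restrict_line[of F u w t] by (simp add: f_def)
    obtain \<alpha> \<beta> where \<alpha>\<beta>: "v = \<alpha> *s u + \<beta> *s w"
      using v(1) plane by blast
    have zero': "eval3 F (x *s u + \<beta> *s w) = 0" if "x \<noteq> 0" for x
    proof -
      have "x *s u + \<beta> *s w = x *s (u + (\<beta> / x) *s w)"
        using that by (simp add: vec_eq_iff algebra_simps)
      then show ?thesis
        by (simp only: eval3_scale[OF hom] zero mult_zero_right)
    qed
    \<comment> \<open>This covers \<open>\<alpha> = 0\<close>, where \<open>v\<close> represents the point missed by the parametrisation.\<close>
    let ?g = "restrict_line F (\<beta> *s w) u"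
    have "[:0, 1:] * ?g = 0"
    proof (rule poly_ext)
      fix x show "poly ([:0, 1:] * ?g) x = poly 0 x"
        using zero'[of x] by (cases "x = 0") (auto simp: poly_restrict_line add.commute)
    qed
    then have "poly ?g \<alpha> = 0"
      by simp
    then show False
      using v(2) by (simp add: poly_restrict_line \<alpha>\<beta> add.commute)
  qed
  have "\<exists>t. u + t *s w \<in> cone_of p" if p: "p \<in> S \<inter> line_of a" for p
  proof -
    obtain x where x: "x \<in> cone_of p" "x \<noteq> 0"
      by (rule cone_of_has_nonzero)
    have cone: "cone_of p = range (\<lambda>k. k *s x)"
      using x by (rule cone_of_nonzero_eq)
    have "eval3 (linear_form a) x = 0"
      using p x by (auto simp: mem_line_of_iff)
    then obtain \<alpha> \<beta> where \<alpha>\<beta>: "x = \<alpha> *s u + \<beta> *s w"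
      using plane by blast
    have "\<alpha> \<noteq> 0"
    proof
      assume "\<alpha> = 0"
      then have "x = \<beta> *s w" "\<beta> \<noteq> 0"
        using \<alpha>\<beta> x(2) by auto
      then have "w = inverse \<beta> *s x"
        by (simp add: vector_smult_assoc)
      then have "w \<in> cone_of p"
        unfolding cone by blast
      then show False
        using w p by blast
    qed
    then have "u + (\<beta> / \<alpha>) *s w = inverse \<alpha> *s x"
      by (simp add: \<alpha>\<beta> vec_eq_iff field_simps)
    then have "u + (\<beta> / \<alpha>) *s w \<in> cone_of p"
      unfolding cone by blast
    then show ?thesis
      by blast
  qed
  then obtain \<tau> where \<tau>: "\<And>p. p \<in> S \<inter> line_of a \<Longrightarrow> u + \<tau> p *s w \<in> cone_of p"
    by metis
  have inj: "inj_on \<tau> (S \<inter> line_of a)"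
    using \<tau> proj_point_eqI nz by (metis inj_onI)
  have "(\<Sum>p\<in>S \<inter> line_of a. curve_mult F p) \<le> (\<Sum>p\<in>S \<inter> line_of a. order (\<tau> p) f)"
  proof (rule sum_mono)
    fix p assume "p \<in> S \<inter> line_of a"
    then have "[:- \<tau> p, 1:] ^ curve_mult F p dvd f"
      unfolding f_def by (intro power_curve_mult_dvd_restrict_line hom \<tau> nz)
    then show "curve_mult F p \<le> order (\<tau> p) f"
      using \<open>f \<noteq> 0\<close> by (simp add: order_divides)
  qed
  also have "\<dots> = (\<Sum>t\<in>\<tau> ` (S \<inter> line_of a). order t f)"
    using inj by (simp add: sum.reindex)
  also have "\<dots> \<le> (\<Sum>t\<in>\<tau> ` (S \<inter> line_of a) \<union> {t. poly f t = 0}. order t f)"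
    using S poly_roots_finite[OF \<open>f \<noteq> 0\<close>] by (intro sum_mono2) auto
  also have "\<dots> = (\<Sum>t | poly f t = 0. order t f)"
    using S poly_roots_finite[OF \<open>f \<noteq> 0\<close>] by (intro sum.mono_neutral_right) (auto simp: order_root)
  also have "\<dots> \<le> degree f"
    using \<open>f \<noteq> 0\<close> by (rule sum_order_le_degree)
  also have "\<dots> \<le> curve_degree F"
    unfolding f_def by (rule degree_restrict_line)
  finally show ?thesis .
qed

text \<open>Restricting to a line through \<open>p\<close> that is not contained in \<open>line_of a\<close> gives a nonzero polynomial of
  degree at most 1, with nonzero constant term if \<open>p\<close> is off \<open>line_of a\<close>.\<close>

lemma curve_mult_line_le:
  assumes "a \<noteq> 0" "c \<noteq> 0" and hom: "homogeneous (Const c * linear_form a)"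
  shows "curve_mult (Const c * linear_form a) p \<le> (if p \<in> line_of a then 1 else 0)"
proof -
  let ?F = "Const c * linear_form a"
  obtain v where v: "v \<in> cone_of p" "v \<noteq> 0"
    by (rule cone_of_has_nonzero)
  obtain w where w: "eval3 (linear_form a) w \<noteq> 0"
    using eval3_eq_0_imp_eq_0 linear_form_nonzero[OF \<open>a \<noteq> 0\<close>] by blast
  let ?f = "[:c * eval3 (linear_form a) v, c * eval3 (linear_form a) w:]"
  have "restrict_line ?F v w = ?f"
  proof (rule poly_ext)
    fix t
    have "eval3 (linear_form a) (v + t *s w)
        = eval3 (linear_form a) v + t * eval3 (linear_form a) w"
      by (simp add: distrib_left sum.distrib sum_distrib_left mult_ac)
    then show "poly (restrict_line ?F v w) t = poly ?f t"
      by (simp add: poly_restrict_line eval3_hom algebra_simps del: eval3_linear_form)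
  qed
  then have "[:- 0, 1:] ^ curve_mult ?F p dvd ?f"
    using power_curve_mult_dvd_restrict_line[OF hom, of v 0 w p] v by simp
  moreover have nz: "?f \<noteq> 0"
    using w \<open>c \<noteq> 0\<close> by (simp del: eval3_linear_form)
  ultimately have le: "curve_mult ?F p \<le> order 0 ?f"
    using order_divides by blast
  show ?thesis
  proof (cases "p \<in> line_of a")
    case True
    have "order 0 ?f \<le> degree ?f"
      using nz by (rule order_degree)
    also have "\<dots> \<le> 1"
      by simp
    finally show ?thesis
      using le True by simp
  next
    case False
    then have "poly ?f 0 \<noteq> 0"
      using v \<open>c \<noteq> 0\<close> by (simp add: mem_line_of_iff del: eval3_linear_form)
    then have "order 0 ?f = 0"
      by (rule order_0I)
    then show ?thesis
      using le by simp
  qed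
qed

lemma curve_mult_linear_form:
  assumes "a \<noteq> 0"
  shows "curve_mult (linear_form a) p = (if p \<in> line_of a then 1 else 0)"
proof -
  have "Const 1 = 1"
    by (rule ring_hom_funD(2)[OF ring_hom_fun_Const])
  then have "curve_mult (linear_form a) p \<le> (if p \<in> line_of a then 1 else 0)"
    using curve_mult_line_le[OF assms, of 1 p] homogeneous_linear_form by simp
  moreover have "curve_mult (linear_form a) p > 0" if "p \<in> line_of a"
    using that homogeneous_linear_form linear_form_nonzero[OF assms]
    by (intro curve_mult_pos) (simp_all add: curve_points_linear_form)
  ultimately show ?thesis
    by (auto split: if_splits)
qed

lemma integral_curve_linear_form: "a \<noteq> 0 \<Longrightarrow> integral_curve (linear_form a)"
  by (simp add: integral_curve_def homogeneous_linear_form irreducible_linear_form)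

section \<open>Seshadri constants of Hirzebruch arrangements\<close>

text \<open>Double counting of the incidences between points and lines.\<close>

lemma sum_over_lines_eq_sum_point_multiplicity:
  fixes f :: "proj_plane \<Rightarrow> nat"
  assumes "finite L" "finite S"
  shows "(\<Sum>l\<in>L. \<Sum>p\<in>S \<inter> l. f p) = (\<Sum>p\<in>S. point_multiplicity L p * f p)"
proof -
  have "(\<Sum>l\<in>L. \<Sum>p\<in>S \<inter> l. f p) = (\<Sum>l\<in>L. \<Sum>p\<in>S. if p \<in> l then f p else 0)"
    using assms(2) by (simp add: sum.inter_restrict)
  also have "\<dots> = (\<Sum>p\<in>S. \<Sum>l\<in>L. if p \<in> l then f p else 0)"
    by (rule sum.swap)
  also have "\<dots> = (\<Sum>p\<in>S. point_multiplicity L p * f p)"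
    using assms(1) by (simp add: point_multiplicity_def flip: sum.inter_filter)
  finally show ?thesis .
qed

text \<open>A curve that contains none of the lines satisfies the stronger bound with \<open>n\<close> in place of
  \<open>n + 1\<close>: summing the bound on each line counts every point at least three times, against
  \<open>3 n\<close> times the degree. The term \<open>n + 1\<close> comes from the lines of the arrangement, for which that
  argument is not available.\<close>

lemma sum_curve_mult_le:
  assumes L: "finite L" "\<And>l. l \<in> L \<Longrightarrow> proj_line l" "card L = 3 * n"
    and S: "finite S" "\<And>p. p \<in> S \<Longrightarrow> point_multiplicity L p \<ge> 3"
    and card: "\<And>l. l \<in> L \<Longrightarrow> card (S \<inter> l) = n + 1"
    and F: "integral_curve F"
  shows "(\<Sum>p\<in>S. curve_mult F p) \<le> (n + 1) * curve_degree F"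
proof (cases "\<exists>a. a \<noteq> 0 \<and> line_of a \<in> L \<and> (\<forall>v. eval3 (linear_form a) v = 0 \<longrightarrow> eval3 F v = 0)")
  case True
  then obtain a where a: "a \<noteq> 0" "line_of a \<in> L"
    and zero: "\<And>v. eval3 (linear_form a) v = 0 \<Longrightarrow> eval3 F v = 0"
    by blast
  have hom: "homogeneous F" and irr: "irreducible F"
    using F by (auto simp: integral_curve_def)
  obtain c where c: "c \<noteq> 0" "F = Const c * linear_form a"
    using irreducible_vanishing_on_line[OF irr a(1)] zero by auto
  \<comment> \<open>A form of degree 0 is constant, and \<open>F\<close> vanishes at the origin.\<close>
  have "curve_degree F \<noteq> 0"
  proof
    assume "curve_degree F = 0"
    then have "eval3 F v = eval3 F 0" for v
      using eval3_scale[OF hom, of 0 v] by simp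
    then have "eval3 F v = 0" for v
      by (simp add: zero)
    then have "F = 0"
      by (rule eval3_eq_0_imp_eq_0)
    then show False
      using irr by simp
  qed
  have "(\<Sum>p\<in>S. curve_mult F p) \<le> (\<Sum>p\<in>S. if p \<in> line_of a then 1 else 0)"
    using hom unfolding c(2) by (intro sum_mono curve_mult_line_le a c)
  also have "\<dots> = n + 1"
    using S(1) card[OF a(2)] by (simp flip: sum.inter_restrict)
  also have "\<dots> \<le> (n + 1) * curve_degree F"
    using \<open>curve_degree F \<noteq> 0\<close> mult_le_mono2[of 1 "curve_degree F" "n + 1"] by simp
  finally show ?thesis .
next
  case False
  have "3 * (\<Sum>p\<in>S. curve_mult F p) \<le> (\<Sum>p\<in>S. point_multiplicity L p * curve_mult F p)"
    unfolding sum_distrib_left using S(2) by (intro sum_mono mult_right_mono) auto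
  also have "\<dots> = (\<Sum>l\<in>L. \<Sum>p\<in>S \<inter> l. curve_mult F p)"
    using L(1) S(1) by (simp add: sum_over_lines_eq_sum_point_multiplicity)
  also have "\<dots> \<le> (\<Sum>l\<in>L. curve_degree F)"
  proof (rule sum_mono)
    fix l assume l: "l \<in> L"
    then obtain a where a: "a \<noteq> 0" "l = line_of a"
      using L(2) proj_line_iff by blast
    then obtain v where "eval3 (linear_form a) v = 0" "eval3 F v \<noteq> 0"
      using False l by blast
    then show "(\<Sum>p\<in>S \<inter> l. curve_mult F p) \<le> curve_degree F"
      unfolding a(2) using F a(1) S(1)
      by (intro sum_curve_mult_on_line_le_degree) (auto simp: integral_curve_def)
  qed
  also have "\<dots> = 3 * (n * curve_degree F)"
    by (simp add: L(3))
  finally show ?thesis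
    by simp
qed

theorem proposition3p3:
  fixes n :: nat and L :: "proj_plane set set"
  assumes "n > 0"
    and "line_arrangement L"
    and "card L = 3 * n"
    and "hirzebruch_property L"
    and "\<And>p. p \<in> Sing L \<Longrightarrow> point_multiplicity L p > 2"
  shows "seshadri (Sing L) = 1 / (real n + 1)"
proof -
  let ?S = "Sing L"
  have L: "finite L" "\<And>l. l \<in> L \<Longrightarrow> proj_line l"
    using assms(2) by (auto simp: line_arrangement_def)
  have card: "card (?S \<inter> l) = n + 1" if l: "l \<in> L" for l
  proof -
    have "?S \<inter> l = {p \<in> l. \<exists>l' \<in> L - {l}. p \<in> l'}"
      using l by (auto simp: Sing_def)
    then show ?thesis
      using assms(3,4) l by (auto simp: hirzebruch_property_def)
  qed
  have "finite (?S \<inter> l)" if "l \<in> L" for l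
    using card[OF that] by (intro card_ge_0_finite) simp
  then have "finite (\<Union>l\<in>L. ?S \<inter> l)"
    using L(1) by blast
  then have S: "finite ?S"
    by (rule finite_subset[rotated]) (auto simp: Sing_def)
  define ratio where "ratio C = real (curve_degree C) / real (\<Sum>p\<in>?S. curve_mult C p)" for C
  define CC where "CC = {C. integral_curve C \<and> curve_points C \<inter> ?S \<noteq> {}}"
  \<comment> \<open>The denominator has to be shown positive, since a quotient by 0 would be 0 and spoil the bound.\<close>
  have lower: "1 / (real n + 1) \<le> ratio C" if "C \<in> CC" for C
  proof -
    from that obtain p where C: "integral_curve C" and p: "p \<in> curve_points C" "p \<in> ?S"
      by (auto simp: CC_def)
    define M where "M = (\<Sum>p\<in>?S. curve_mult C p)"
    have "curve_mult C p > 0"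
      using C p(1) by (intro curve_mult_pos) (auto simp: integral_curve_def)
    then have "M > 0"
      unfolding M_def using p(2) S by (intro sum_pos2) auto
    moreover have "M \<le> (n + 1) * curve_degree C"
      unfolding M_def using L assms(3) S card C assms(5) by (intro sum_curve_mult_le[where L = L]) force+
    then have "real M \<le> (real n + 1) * real (curve_degree C)"
      by (metis of_nat_1 of_nat_add of_nat_le_iff of_nat_mult)
    ultimately show ?thesis
      unfolding ratio_def M_def[symmetric] by (simp add: field_simps)
  qed
  obtain l where l: "l \<in> L"
    using assms(1,3) by fastforce
  then obtain a where a: "a \<noteq> 0" "l = line_of a"
    using L(2) proj_line_iff by blast
  have "?S \<inter> l \<noteq> {}"
    using card[OF l] by auto
  then have mem: "linear_form a \<in> CC"
    using a by (auto simp: CC_def integral_curve_linear_form curve_points_linear_form)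
  have "(\<Sum>p\<in>?S. curve_mult (linear_form a) p) = card (?S \<inter> l)"
    using S a by (simp add: curve_mult_linear_form flip: sum.inter_restrict)
  then have attained: "ratio (linear_form a) = 1 / (real n + 1)"
    using a(1) card[OF l] by (simp add: ratio_def curve_degree_linear_form add.commute)
  have "(INF C\<in>CC. ratio C) = 1 / (real n + 1)"
  proof (rule antisym)
    have "bdd_below (ratio ` CC)"
      using lower by (intro bdd_belowI2)
    then show "(INF C\<in>CC. ratio C) \<le> 1 / (real n + 1)"
      unfolding attained[symmetric] using mem by (rule cINF_lower)
    show "1 / (real n + 1) \<le> (INF C\<in>CC. ratio C)"
      using mem lower by (intro cINF_greatest) auto
  qed
  then show ?thesis
    by (simp add: seshadri_def ratio_def CC_def)
qed

end
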